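(* Suppose $(u_j^n,v_j^n)\in D_K^\lambda$ for all $j\in\mathbb Z$. For each $j$, let $(u^R_{j+1/2}(t),v^R_{j+1/2}(t))$ be the solution of $$\frac{d}{dt}u=0,\qquad \frac{d}{dt}v=\frac1\varepsilon(g(u)-v),\qquad (u,v)(0)=(u_{j+1}^n,v_{j+1}^n).$$ Then for all $j\in\mathbb Z$ and all $t>0$, $$r^R_{j+1/2}(t):=u^R_{j+1/2}(t)+\tfrac1\lambda v^R_{j+1/2}(t)\in K_+,\qquad s^R_{j+1/2}(t):=u^R_{j+1/2}(t)-\tfrac1\lambda v^R_{j+1/2}(t)\in K_-.$$ Moreover, under the subcharacteristic condition $\lambda>\max_{u\in K}\rho(\nabla_u g(u))$ and the CFL condition $\lambda\,\Delta t\le\Delta x$, if $(u_j^n,v_j^n)\in D_K^\lambda$ for all $j\in\mathbb Z$, then $u_{j-1/2}^{n+1/2}\in K$ for all $j\in\mathbb Z$, where $$u_{j-1/2}^{n+1/2}=\frac{u_{j-1}^n+u_j^n}{2}-\frac{\Delta t}{2\Delta x}\Big((v_j^n-g(u_j^n))e^{-\Delta t/(2\varepsilon)}+g(u_j^n)-(v_{j-1}^n-g(u_{j-1}^n))e^{-\Delta t/(2\varepsilon)}-g(u_{j-1}^n)\Big).$$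
   Context: Jin–Xin model: $\partial_tu+\partial_xv=0$, $\partial_tv+\lambda^2\partial_xu=\frac1\varepsilon(g(u)-v)$, with $\varepsilon>0$, $\lambda>0$, a relaxation of the system of conservation laws $\partial_tu+\partial_xg(u)=0$, where $g$ is of class $C^2$ on a convex set $K$ of admissible states (in some $\mathbb R^m$). $\rho(\nabla_ug(u))$ is the spectral radius of the Jacobian of $g$. Throughout, the wave speed satisfies the subcharacteristic condition $\lambda>\max_{u\in K}\rho(\nabla_ug(u))$. Set $h_\pm(u)=u\pm\frac1\lambda g(u)$ and $K_\pm=h_\pm(K)$. The following properties, recalled from the literature (Serre), are taken as given in this setting: $K_+$ and $K_-$ are convex, and $K=\frac12(K_++K_-)=\{\frac12(a+b):a\in K_+,\,b\in K_-\}$. Define $$D_K^\lambda=\{(u,v):\ u+\tfrac1\lambda v\in K_+\ \text{and}\ u-\tfrac1\lambda v\in K_-\}.$$ $\Delta t,\Delta x>0$ are the time and space steps; $(u_j^n,v_j^n)_{j\in\mathbb Z}$ are the discrete values at time $t^n$; $u_{j-1/2}^{n+1/2}$ is the half-step value of $u$ in the staggered scheme. *)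

theory Defs
  imports "HOL-Analysis.Analysis"
begin

(* K need not be open, so C^2 on K means C^2 on an open neighbourhood of K; in particular the
   Jacobian "jacobian g (at u)" is meaningful at every u in K. *)
definition C2_on :: "'a::real_normed_vector set \<Rightarrow> ('a \<Rightarrow> 'b::real_normed_vector) \<Rightarrow> bool" where
  "C2_on S f \<longleftrightarrow>
    (\<exists>U (f' :: 'a \<Rightarrow> 'a \<Rightarrow>\<^sub>L 'b) (f'' :: 'a \<Rightarrow> 'a \<Rightarrow>\<^sub>L 'a \<Rightarrow>\<^sub>L 'b).
      open U \<and> S \<subseteq> U \<and>
      (\<forall>x\<in>U. (f has_derivative blinfun_apply (f' x)) (at x)) \<and>
      (\<forall>x\<in>U. (f' has_derivative blinfun_apply (f'' x)) (at x)) \<and>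
      continuous_on U f'')"

(* A real matrix is read as a complex one: its non-real eigenvalues count. *)
definition spectrum :: "real^'m^'m \<Rightarrow> complex set" where
  "spectrum A = {z. \<exists>x::complex^'m. x \<noteq> 0 \<and> map_matrix complex_of_real A *v x = z *s x}"

definition spectral_radius :: "real^'m^'m \<Rightarrow> real" where
  "spectral_radius A = Max (cmod ` spectrum A)"

(* The condition lam > max over u in K, stated pointwise: this is what it says when the maximum
   is attained, and it does not presuppose that it is. *)
definition subcharacteristic :: "(real^'m \<Rightarrow> real^'m) \<Rightarrow> (real^'m) set \<Rightarrow> real \<Rightarrow> bool" where
  "subcharacteristic g K lam \<longleftrightarrow> (\<forall>u\<in>K. spectral_radius (jacobian g (at u)) < lam)"

definition h_plus :: "real \<Rightarrow> ('a \<Rightarrow> 'a) \<Rightarrow> 'a \<Rightarrow> 'a::real_vector" where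
  "h_plus lam g u = u + (1 / lam) *\<^sub>R g u"

definition h_minus :: "real \<Rightarrow> ('a \<Rightarrow> 'a) \<Rightarrow> 'a \<Rightarrow> 'a::real_vector" where
  "h_minus lam g u = u - (1 / lam) *\<^sub>R g u"

definition K_plus :: "real \<Rightarrow> ('a \<Rightarrow> 'a) \<Rightarrow> 'a set \<Rightarrow> 'a::real_vector set" where
  "K_plus lam g K = h_plus lam g ` K"

definition K_minus :: "real \<Rightarrow> ('a \<Rightarrow> 'a) \<Rightarrow> 'a set \<Rightarrow> 'a::real_vector set" where
  "K_minus lam g K = h_minus lam g ` K"

definition D_set :: "real \<Rightarrow> ('a \<Rightarrow> 'a) \<Rightarrow> 'a set \<Rightarrow> ('a::real_vector \<times> 'a) set" where
  "D_set lam g K =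
    {(u, v). u + (1 / lam) *\<^sub>R v \<in> K_plus lam g K \<and> u - (1 / lam) *\<^sub>R v \<in> K_minus lam g K}"

definition relaxation_solution ::
  "('a \<Rightarrow> 'a) \<Rightarrow> real \<Rightarrow> 'a \<Rightarrow> 'a \<Rightarrow> (real \<Rightarrow> 'a) \<Rightarrow> (real \<Rightarrow> 'a::real_normed_vector) \<Rightarrow> bool" where
  "relaxation_solution g \<epsilon> u0 v0 u v \<longleftrightarrow>
    u 0 = u0 \<and> v 0 = v0 \<and>
    (\<forall>t\<ge>0. (u has_vector_derivative 0) (at t within {0..}) \<and>
           (v has_vector_derivative (1 / \<epsilon>) *\<^sub>R (g (u t) - v t)) (at t within {0..}))"

end

theory Submission
  imports Defs
begin

text \<open>
  The characteristic variables \<open>r = u + v / \<lambda>\<close> and \<open>s = u - v / \<lambda>\<close> turn the set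
  \<open>D\<close> into a product of convex sets: \<open>(u, v) \<in> D\<close> iff \<open>r \<in> K\<^sub>+\<close> and \<open>s \<in> K\<^sub>-\<close>.
  Both claims then reduce to taking convex combinations within \<open>K\<^sub>+\<close> and within \<open>K\<^sub>-\<close>.

  The relaxation step freezes \<open>u\<close> and moves \<open>v\<close> along the segment from its initial value to the
  equilibrium \<open>g u\<close>, so \<open>r\<close> and \<open>s\<close> move along segments that end at \<open>h\<^sub>+ u\<close> and \<open>h\<^sub>- u\<close>. These
  endpoints lie in \<open>K\<^sub>+\<close> and \<open>K\<^sub>-\<close> as soon as \<open>u \<in> K\<close>, and \<open>u \<in> K\<close> because \<open>u\<close> is the midpoint
  of \<open>r\<close> and \<open>s\<close> (lemmas \<open>relaxation_solution_exp\<close> and \<open>relax_in_D_set\<close>).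

  In the staggered scheme the fluxes are the values \<open>w\<close> that \<open>v\<close> takes after relaxing for half a
  time step, so the pairs \<open>(u, w)\<close> are again in \<open>D\<close>. Written in characteristic variables, the
  Lax-Friedrichs type average is the midpoint of an average of the two values of \<open>r\<close> and an average
  of the two values of \<open>s\<close>, with weights \<open>(1 \<plusminus> \<mu>) / 2\<close> where \<open>\<mu> = \<lambda> \<Delta>t / \<Delta>x\<close>; the CFL condition
  makes these weights nonnegative (lemma \<open>staggered_average_mem\<close>).
\<close>

text \<open>
  Once \<open>u\<close> is known to be constant, \<open>g\<close> is only evaluated at \<open>u0\<close>, so the equation for the
  deviation \<open>v - g u0\<close> from equilibrium is linear: multiplying by the integrating factor
  \<open>exp (t / \<epsilon>)\<close> gives a function with zero derivative.
\<close>
lemma relaxation_solution_exp: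
  fixes g :: "'a::real_normed_vector \<Rightarrow> 'a"
  assumes sol: "relaxation_solution g \<epsilon> u0 v0 u v" and t: "t \<ge> 0"
  shows "u t = u0" and "v t = exp (- t / \<epsilon>) *\<^sub>R (v0 - g u0) + g u0"
proof -
  have u0: "u 0 = u0" and v0: "v 0 = v0"
    and du: "\<And>t. t \<ge> 0 \<Longrightarrow> (u has_vector_derivative 0) (at t within {0..})"
    and dv: "\<And>t. t \<ge> 0 \<Longrightarrow>
               (v has_vector_derivative (1 / \<epsilon>) *\<^sub>R (g (u t) - v t)) (at t within {0..})"
    using sol unfolding relaxation_solution_def by auto
  have u_const: "u s = u0" if "s \<ge> 0" for s
  proof -
    obtain c where "\<And>x. x \<in> {0..} \<Longrightarrow> u x = c"
      using has_vector_derivative_zero_constant[of "{0..}" u] du by auto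
    then show ?thesis using u0 that by force
  qed
  then show "u t = u0" using t .
  define z where "z s = exp (s / \<epsilon>) *\<^sub>R (v s - g u0)" for s
  have "(z has_vector_derivative 0) (at s within {0..})" if "s \<ge> 0" for s
  proof -
    have "((\<lambda>s. exp (s / \<epsilon>)) has_field_derivative exp (s / \<epsilon>) * (1 / \<epsilon>)) (at s within {0..})"
      using DERIV_chain2[OF DERIV_exp DERIV_cdivide[OF DERIV_ident]] .
    then have "(z has_vector_derivative
        exp (s / \<epsilon>) *\<^sub>R ((1 / \<epsilon>) *\<^sub>R (g u0 - v s)) + (exp (s / \<epsilon>) * (1 / \<epsilon>)) *\<^sub>R (v s - g u0))
        (at s within {0..})"
      unfolding z_def using dv[OF that] u_const[OF that]
      by (intro has_vector_derivative_scaleR) (auto intro!: derivative_eq_intros)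
    then show ?thesis by (simp add: algebra_simps)
  qed
  then obtain c where c: "\<And>x. x \<in> {0..} \<Longrightarrow> z x = c"
    using has_vector_derivative_zero_constant[of "{0..}" z] by auto
  have "z t = z 0" using c t by simp
  then have "exp (t / \<epsilon>) *\<^sub>R (v t - g u0) = v0 - g u0"
    by (simp add: z_def v0)
  then have "exp (- t / \<epsilon>) *\<^sub>R (exp (t / \<epsilon>) *\<^sub>R (v t - g u0)) = exp (- t / \<epsilon>) *\<^sub>R (v0 - g u0)"
    by simp
  moreover have "exp (- t / \<epsilon>) *\<^sub>R (exp (t / \<epsilon>) *\<^sub>R (v t - g u0)) = v t - g u0"
    by (simp add: exp_minus)
  ultimately have "v t - g u0 = exp (- t / \<epsilon>) *\<^sub>R (v0 - g u0)"
    by simp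
  then show "v t = exp (- t / \<epsilon>) *\<^sub>R (v0 - g u0) + g u0"
    by (simp only: diff_eq_eq)
qed

lemma u_mem_if_D_set:
  assumes K: "K = {(1 / 2) *\<^sub>R (a + b) | a b. a \<in> K_plus lam g K \<and> b \<in> K_minus lam g K}"
    and D: "(u, v) \<in> D_set lam g K"
  shows "u \<in> K"
proof -
  have "u = (1 / 2) *\<^sub>R ((u + (1 / lam) *\<^sub>R v) + (u - (1 / lam) *\<^sub>R v))"
    by (simp flip: scaleR_2)
  moreover have "u + (1 / lam) *\<^sub>R v \<in> K_plus lam g K" "u - (1 / lam) *\<^sub>R v \<in> K_minus lam g K"
    using D by (auto simp: D_set_def)
  ultimately show ?thesis by (subst K) blast
qed

text \<open>
  Moving \<open>v\<close> towards the equilibrium \<open>g u\<close> moves each characteristic variable towards \<open>h\<^sub>\<plusminus> u\<close>,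
  a point of the same convex set.
\<close>
lemma relax_in_D_set:
  assumes "convex (K_plus lam g K)" and "convex (K_minus lam g K)"
    and "u \<in> K" and "(u, v) \<in> D_set lam g K" and "0 \<le> \<theta>" and "\<theta> \<le> 1"
  shows "(u, \<theta> *\<^sub>R (v - g u) + g u) \<in> D_set lam g K"
proof -
  let ?w = "\<theta> *\<^sub>R (v - g u) + g u"
  have D: "u + (1 / lam) *\<^sub>R v \<in> K_plus lam g K" "u - (1 / lam) *\<^sub>R v \<in> K_minus lam g K"
    using assms(4) by (auto simp: D_set_def)
  have h: "h_plus lam g u \<in> K_plus lam g K" "h_minus lam g u \<in> K_minus lam g K"
    using assms(3) by (auto simp: K_plus_def K_minus_def)
  have "u + (1 / lam) *\<^sub>R ?w = (1 - \<theta>) *\<^sub>R h_plus lam g u + \<theta> *\<^sub>R (u + (1 / lam) *\<^sub>R v)"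
    by (simp add: h_plus_def algebra_simps diff_divide_distrib)
  then have "u + (1 / lam) *\<^sub>R ?w \<in> K_plus lam g K"
    using convexD_alt[OF assms(1) h(1) D(1)] assms(5,6) by simp
  moreover
  have "u - (1 / lam) *\<^sub>R ?w = (1 - \<theta>) *\<^sub>R h_minus lam g u + \<theta> *\<^sub>R (u - (1 / lam) *\<^sub>R v)"
    by (simp add: h_minus_def algebra_simps diff_divide_distrib)
  then have "u - (1 / lam) *\<^sub>R ?w \<in> K_minus lam g K"
    using convexD_alt[OF assms(2) h(2) D(2)] assms(5,6) by simp
  ultimately show ?thesis by (simp add: D_set_def)
qed

text \<open>
  Substituting \<open>u = (r + s) / 2\<close> and \<open>w = \<lambda> (r - s) / 2\<close> decouples the update. For \<open>\<lambda> > 0\<close> and \<open>\<kappa> \<ge> 0\<close>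
  it is upwinded: the right-going \<open>r\<close> is weighted towards the left state and the left-going \<open>s\<close>
  towards the right state. Each average stays in its own convex set.
\<close>
lemma staggered_average_mem:
  assumes "convex (K_plus lam g K)" and "convex (K_minus lam g K)"
    and K: "K = {(1 / 2) *\<^sub>R (a + b) | a b. a \<in> K_plus lam g K \<and> b \<in> K_minus lam g K}"
    and l: "(ul, wl) \<in> D_set lam g K" and r: "(ur, wr) \<in> D_set lam g K"
    and "lam \<noteq> 0" and "\<bar>lam * \<kappa>\<bar> \<le> 1"
  shows "(1 / 2) *\<^sub>R (ul + ur) - (\<kappa> / 2) *\<^sub>R (wr - wl) \<in> K"
proof -
  define \<mu> where "\<mu> = lam * \<kappa>"
  have \<mu>: "- 1 \<le> \<mu>" "\<mu> \<le> 1" and \<kappa>: "\<kappa> = \<mu> / lam"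
    using assms(6,7) by (auto simp: \<mu>_def)
  define rl rr sl sr
    where "rl = ul + (1 / lam) *\<^sub>R wl" and "rr = ur + (1 / lam) *\<^sub>R wr"
      and "sl = ul - (1 / lam) *\<^sub>R wl" and "sr = ur - (1 / lam) *\<^sub>R wr"
  have mem: "rl \<in> K_plus lam g K" "rr \<in> K_plus lam g K" "sl \<in> K_minus lam g K" "sr \<in> K_minus lam g K"
    using l r by (auto simp: D_set_def rl_def rr_def sl_def sr_def)
  define a where "a = ((1 + \<mu>) / 2) *\<^sub>R rl + ((1 - \<mu>) / 2) *\<^sub>R rr"
  define b where "b = ((1 - \<mu>) / 2) *\<^sub>R sl + ((1 + \<mu>) / 2) *\<^sub>R sr"
  have ab: "a \<in> K_plus lam g K" "b \<in> K_minus lam g K"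
    unfolding a_def b_def using \<mu> mem
    by (auto intro!: convexD assms(1,2) simp: field_simps)
  have u: "ul = (1 / 2) *\<^sub>R (rl + sl)" "ur = (1 / 2) *\<^sub>R (rr + sr)"
    by (simp_all add: rl_def rr_def sl_def sr_def flip: scaleR_2)
  have w: "(1 / lam) *\<^sub>R wl = (1 / 2) *\<^sub>R (rl - sl)" "(1 / lam) *\<^sub>R wr = (1 / 2) *\<^sub>R (rr - sr)"
    by (simp_all add: rl_def rr_def sl_def sr_def flip: scaleR_2)
  have "(\<kappa> / 2) *\<^sub>R (wr - wl) = (\<mu> / 2) *\<^sub>R ((1 / lam) *\<^sub>R wr - (1 / lam) *\<^sub>R wl)"
    by (simp add: \<kappa> scaleR_diff_right mult.commute)
  also have "\<dots> = (\<mu> / 4) *\<^sub>R (rr - sr - rl + sl)"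
    by (simp add: w algebra_simps)
  finally have "(1 / 2) *\<^sub>R (ul + ur) - (\<kappa> / 2) *\<^sub>R (wr - wl)
      = (1 / 4) *\<^sub>R (rl + sl + rr + sr) - (\<mu> / 4) *\<^sub>R (rr - sr - rl + sl)"
    by (simp add: u algebra_simps)
  also have "\<dots> = (1 / 2) *\<^sub>R (a + b)"
    by (simp add: a_def b_def add_divide_distrib diff_divide_distrib algebra_simps)
  finally show ?thesis using ab by (subst K) auto
qed

theorem proposition2:
  fixes g :: "real^'m \<Rightarrow> real^'m"
    and K :: "(real^'m) set"
    and lam \<epsilon> \<Delta>t \<Delta>x :: real
    and u v :: "nat \<Rightarrow> int \<Rightarrow> real^'m"
    and n :: nat
  assumes "\<epsilon> > 0" and "lam > 0" and "\<Delta>t > 0" and "\<Delta>x > 0"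
    and "convex K"
    and "C2_on K g"
    and "subcharacteristic g K lam"
    and "convex (K_plus lam g K)"
    and "convex (K_minus lam g K)"
    and "K = {(1 / 2) *\<^sub>R (a + b) | a b. a \<in> K_plus lam g K \<and> b \<in> K_minus lam g K}"
    and "\<forall>j. (u n j, v n j) \<in> D_set lam g K"
  shows "(\<forall>uR vR :: int \<Rightarrow> real \<Rightarrow> real^'m.
            (\<forall>j. relaxation_solution g \<epsilon> (u n (j + 1)) (v n (j + 1)) (uR j) (vR j)) \<longrightarrow>
            (\<forall>j. \<forall>t>0. uR j t + (1 / lam) *\<^sub>R vR j t \<in> K_plus lam g K \<and>
                       uR j t - (1 / lam) *\<^sub>R vR j t \<in> K_minus lam g K)) \<and>
         (lam * \<Delta>t \<le> \<Delta>x \<longrightarrow>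
            (\<forall>j. (1 / 2) *\<^sub>R (u n (j - 1) + u n j)
                 - (\<Delta>t / (2 * \<Delta>x)) *\<^sub>R
                     (exp (- \<Delta>t / (2 * \<epsilon>)) *\<^sub>R (v n j - g (u n j)) + g (u n j)
                      - exp (- \<Delta>t / (2 * \<epsilon>)) *\<^sub>R (v n (j - 1) - g (u n (j - 1)))
                      - g (u n (j - 1)))
                 \<in> K))"
proof (intro conjI allI impI)
  have K: "u n j \<in> K" for j
    using u_mem_if_D_set[OF assms(10)] assms(11) by blast
  have relaxed: "(u n j, \<theta> *\<^sub>R (v n j - g (u n j)) + g (u n j)) \<in> D_set lam g K"
    if "0 \<le> \<theta>" "\<theta> \<le> 1" for \<theta> j
    using relax_in_D_set[OF assms(8,9) K _ that] assms(11) by blast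
  {
    fix uR vR :: "int \<Rightarrow> real \<Rightarrow> real^'m" and j :: int and t :: real
    assume sol: "\<forall>j. relaxation_solution g \<epsilon> (u n (j + 1)) (v n (j + 1)) (uR j) (vR j)" and "t > 0"
    have "(uR j t, vR j t) \<in> D_set lam g K"
      using relaxation_solution_exp[OF sol[rule_format, of j], of t]
        relaxed[of "exp (- t / \<epsilon>)" "j + 1"] \<open>t > 0\<close> \<open>\<epsilon> > 0\<close>
      by simp
    then show "uR j t + (1 / lam) *\<^sub>R vR j t \<in> K_plus lam g K"
      and "uR j t - (1 / lam) *\<^sub>R vR j t \<in> K_minus lam g K"
      by (auto simp: D_set_def)
  }
  fix j
  assume cfl: "lam * \<Delta>t \<le> \<Delta>x"
  define \<theta> where "\<theta> = exp (- \<Delta>t / (2 * \<epsilon>))"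
  define w where "w i = \<theta> *\<^sub>R (v n i - g (u n i)) + g (u n i)" for i
  have \<theta>: "0 \<le> \<theta>" "\<theta> \<le> 1"
    using assms(1,3) by (auto simp: \<theta>_def)
  have D: "(u n i, w i) \<in> D_set lam g K" for i
    using relaxed[OF \<theta>] by (simp add: w_def)
  have "\<bar>lam * (\<Delta>t / \<Delta>x)\<bar> \<le> 1"
    using cfl assms(2-4) by (simp add: abs_mult)
  then have "(1 / 2) *\<^sub>R (u n (j - 1) + u n j) - ((\<Delta>t / \<Delta>x) / 2) *\<^sub>R (w j - w (j - 1)) \<in> K"
    by (intro staggered_average_mem[OF assms(8-10) D D]) (use assms(2) in simp_all)
  then show "(1 / 2) *\<^sub>R (u n (j - 1) + u n j)
      - (\<Delta>t / (2 * \<Delta>x)) *\<^sub>R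
          (exp (- \<Delta>t / (2 * \<epsilon>)) *\<^sub>R (v n j - g (u n j)) + g (u n j)
           - exp (- \<Delta>t / (2 * \<epsilon>)) *\<^sub>R (v n (j - 1) - g (u n (j - 1)))
           - g (u n (j - 1))) \<in> K"
    by (simp add: w_def \<theta>_def mult.commute diff_diff_eq)
qed

end
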